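(* Let $\mathsf{JL}$ be any justification logic from the list in the context and $\mathsf{CS}$ a constant specification for $\mathsf{JL}$. The rules of contraction $$\frac{\varphi,\varphi,\Gamma\Rightarrow\Delta}{\varphi,\Gamma\Rightarrow\Delta}\ (LC)\qquad\qquad\frac{\Gamma\Rightarrow\Delta,\varphi,\varphi}{\Gamma\Rightarrow\Delta,\varphi}\ (RC),$$ where $\varphi$ is any formula of one of the forms $w\Vvdash A$, $wRv$, $wE(t,A)$, are height-preserving $\mathsf{CS}$-admissible in $\mathsf{G3JL}_{\mathsf{CS}}$.
   Context: Justification logics. Terms are built from justification variables and constants by binary $\cdot,+$ and (depending on the logic) unary $!$, $?$, $\bar{?}$. Formulas are built from propositional variables and $\bot$ by $\neg,\wedge,\vee,\to$ and $t:A$. $\mathsf J$ has axiom schemes: propositional tautologies; $s:A\to(s+t):A$, $s:A\to(t+s):A$; $s:(A\to B)\to(t:A\to(s\cdot t):B)$. A justification logic $\mathsf{JL}$ is $\mathsf J$ extended by at most one of (jT) $t:A\to A$, (jD) $t:\bot\to\bot$, and by any subset of (j4) $t:A\to\,!t:t:A$, (jB) $\neg A\to\bar{?}t:\neg t:A$, (j5) $\neg t:A\to\,?t:\neg t:A$; its language contains $!$ (resp. $\bar{?}$, $?$) exactly when (j4) (resp. (jB), (j5)) is an axiom. A constant specification $\mathsf{CS}$ for $\mathsf{JL}$: if (j4) is not an axiom, a set of formulas $c_n:\dots:c_1:A$ ($n\ge1$, $c_j$ constants, $A$ an axiom instance), closed under passing from $c_n:c_{n-1}:\dots:c_1:A$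 to $c_{n-1}:\dots:c_1:A$; if (j4) is an axiom, a set of formulas $c:A$ ($c$ a constant, $A$ an axiom instance). Calculus $\mathsf{G3JL}_{\mathsf{CS}}$. Fix a countably infinite set of labels $w,v,u,\dots$. The labeled language has labeled formulas $w\Vvdash A$, relational atoms $wRv$ and evidence atoms $wE(t,A)$ ($A$ a formula, $t$ a term). Sequents $\Gamma\Rightarrow\Delta$ consist of finite multisets of these. Initial sequents: $w\Vvdash P,\Gamma\Rightarrow\Delta,w\Vvdash P$ ($P$ a propositional variable); $w\Vvdash\bot,\Gamma\Rightarrow\Delta$; $wRv,\Gamma\Rightarrow\Delta,wRv$; $wE(t,A),\Gamma\Rightarrow\Delta,wE(t,A)$. Rules (premises / conclusion): (L$\neg$) $\Gamma\Rightarrow\Delta,w\Vvdash A$ / $w\Vvdash\neg A,\Gamma\Rightarrow\Delta$; (R$\neg$) $w\Vvdash A,\Gamma\Rightarrow\Delta$ / $\Gamma\Rightarrow\Delta,w\Vvdash\neg A$; (L$\wedge$) $w\Vvdash A,w\Vvdash B,\Gamma\Rightarrow\Delta$ / $w\Vvdash A\wedge B,\Gamma\Rightarrow\Delta$; (R$\wedge$) $\Gamma\Rightarrow\Delta,w\Vvdash A$ and $\Gamma\Rightarrow\Delta,w\Vvdash B$ / $\Gamma\Rightarrow\Delta,w\Vvdash A\wedge B$; (L$\vee$) $w\Vvdash A,\Gamma\Rightarrow\Delta$ and $w\Vvdash B,\Gamma\Rightarrow\Delta$ / $w\Vvdash A\vee B,\Gamma\Rightarrow\Delta$; (R$\vee$)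 $\Gamma\Rightarrow\Delta,w\Vvdash A,w\Vvdash B$ / $\Gamma\Rightarrow\Delta,w\Vvdash A\vee B$; (L$\to$) $\Gamma\Rightarrow\Delta,w\Vvdash A$ and $w\Vvdash B,\Gamma\Rightarrow\Delta$ / $w\Vvdash A\to B,\Gamma\Rightarrow\Delta$; (R$\to$) $w\Vvdash A,\Gamma\Rightarrow\Delta,w\Vvdash B$ / $\Gamma\Rightarrow\Delta,w\Vvdash A\to B$; (L:) $v\Vvdash A,w\Vvdash t:A,wRv,\Gamma\Rightarrow\Delta$ / $w\Vvdash t:A,wRv,\Gamma\Rightarrow\Delta$; (R:) $wRv,wE(t,A),\Gamma\Rightarrow\Delta,v\Vvdash A$ / $wE(t,A),\Gamma\Rightarrow\Delta,w\Vvdash t:A$, where the eigenlabel $v$ does not occur in the conclusion; (E) $wE(t,A),w\Vvdash t:A,\Gamma\Rightarrow\Delta$ / $w\Vvdash t:A,\Gamma\Rightarrow\Delta$; (El+) $wE(s+t,A),wE(t,A),\Gamma\Rightarrow\Delta$ / $wE(t,A),\Gamma\Rightarrow\Delta$; (Er+) $wE(t+s,A),wE(t,A),\Gamma\Rightarrow\Delta$ / $wE(t,A),\Gamma\Rightarrow\Delta$; (E$\cdot$) $wE(s\cdot t,B),wE(s,A\to B),wE(t,A),\Gamma\Rightarrow\Delta$ / $wE(s,A\to B),wE(t,A),\Gamma\Rightarrow\Delta$; (IAN)/(AN) $wE(c,F),\Gamma\Rightarrow\Delta$ / $\Gamma\Rightarrow\Delta$, for $c:F\in\mathsf{CS}$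 ($c$ a constant). If (jT) is an axiom: (Ref) $wRw,\Gamma\Rightarrow\Delta$ / $\Gamma\Rightarrow\Delta$. If (jD) is an axiom: (Ser) $wRv,\Gamma\Rightarrow\Delta$ / $\Gamma\Rightarrow\Delta$, where the eigenlabel $v$ does not occur in the conclusion. If (j4) is an axiom: (E!) $wE(!t,t:A),wE(t,A),\Gamma\Rightarrow\Delta$ / $wE(t,A),\Gamma\Rightarrow\Delta$; (Mon) $vE(t,A),wE(t,A),wRv,\Gamma\Rightarrow\Delta$ / $wE(t,A),wRv,\Gamma\Rightarrow\Delta$; (Trans) $wRu,wRv,vRu,\Gamma\Rightarrow\Delta$ / $wRv,vRu,\Gamma\Rightarrow\Delta$. If (jB) is an axiom: (E$\bar{?}$) $w\Vvdash A,\Gamma\Rightarrow\Delta$ and $wE(\bar{?}t,\neg t:A),\Gamma\Rightarrow\Delta$ / $\Gamma\Rightarrow\Delta$; (Sym) $vRw,wRv,\Gamma\Rightarrow\Delta$ / $wRv,\Gamma\Rightarrow\Delta$. If (j5) is an axiom: (SE) $w\Vvdash t:A,wE(t,A),\Gamma\Rightarrow\Delta$ / $wE(t,A),\Gamma\Rightarrow\Delta$; (E?) $wE(t,A),\Gamma\Rightarrow\Delta$ and $wE(?t,\neg t:A),\Gamma\Rightarrow\Delta$ / $\Gamma\Rightarrow\Delta$. The height of a derivation is the maximum number of successive rule applications in it. "Derivable with height $n$" means having a derivation of height at most $n$. A rule is height-preserving $\mathsf{CS}$-admissible if whenever an instance of its premise(s) is derivable in $\mathsf{G3JL}_{\mathsf{CS}}$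 with height $n$, then so is the corresponding instance of its conclusion. *)

theory Defs
  imports Main "HOL-Library.Multiset"
begin

datatype ext_axiom = jT | jD | j4 | jB | j5

text \<open>A justification logic is given by the set of axioms it adds to J.\<close>

type_synonym logic = "ext_axiom set"

definition justification_logic :: "logic \<Rightarrow> bool" where
  "justification_logic L \<longleftrightarrow> \<not> (jT \<in> L \<and> jD \<in> L)"


text \<open>
  The types of constants \<open>'c\<close>, justification variables \<open>'v\<close> and propositional variables
  \<open>'p\<close> are left arbitrary. The datatypes contain the operations \<open>!\<close> (\<open>Bang\<close>),
  \<open>?\<close> (\<open>Quest\<close>) and \<open>?\<close> with a bar (\<open>BarQuest\<close>); the predicates
  \<open>tm_lang\<close>, \<open>fm_lang\<close> single out the terms and formulas in the language of a given logic.
\<close>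

datatype ('c, 'v) tm =
    JVar 'v
  | JConst 'c
  | App "('c, 'v) tm" "('c, 'v) tm"  (infixl "\<cdot>" 75)
  | Plus "('c, 'v) tm" "('c, 'v) tm"  (infixl "\<oplus>" 70)
  | Bang "('c, 'v) tm"
  | Quest "('c, 'v) tm"
  | BarQuest "('c, 'v) tm"

datatype ('c, 'v, 'p) fm =
    PVar 'p
  | Bot
  | Neg "('c, 'v, 'p) fm"
  | Con "('c, 'v, 'p) fm" "('c, 'v, 'p) fm"
  | Dis "('c, 'v, 'p) fm" "('c, 'v, 'p) fm"
  | Imp "('c, 'v, 'p) fm" "('c, 'v, 'p) fm"
  | Just "('c, 'v) tm" "('c, 'v, 'p) fm"

primrec tm_lang :: "logic \<Rightarrow> ('c, 'v) tm \<Rightarrow> bool" where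
  "tm_lang L (JVar x) \<longleftrightarrow> True"
| "tm_lang L (JConst c) \<longleftrightarrow> True"
| "tm_lang L (s \<cdot> t) \<longleftrightarrow> tm_lang L s \<and> tm_lang L t"
| "tm_lang L (s \<oplus> t) \<longleftrightarrow> tm_lang L s \<and> tm_lang L t"
| "tm_lang L (Bang t) \<longleftrightarrow> j4 \<in> L \<and> tm_lang L t"
| "tm_lang L (Quest t) \<longleftrightarrow> j5 \<in> L \<and> tm_lang L t"
| "tm_lang L (BarQuest t) \<longleftrightarrow> jB \<in> L \<and> tm_lang L t"

primrec fm_lang :: "logic \<Rightarrow> ('c, 'v, 'p) fm \<Rightarrow> bool" where
  "fm_lang L (PVar p) \<longleftrightarrow> True"
| "fm_lang L Bot \<longleftrightarrow> True"
| "fm_lang L (Neg A) \<longleftrightarrow> fm_lang L A"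
| "fm_lang L (Con A B) \<longleftrightarrow> fm_lang L A \<and> fm_lang L B"
| "fm_lang L (Dis A B) \<longleftrightarrow> fm_lang L A \<and> fm_lang L B"
| "fm_lang L (Imp A B) \<longleftrightarrow> fm_lang L A \<and> fm_lang L B"
| "fm_lang L (Just t A) \<longleftrightarrow> tm_lang L t \<and> fm_lang L A"


text \<open>
  Propositional tautologies: true under all Boolean valuations in which the propositional
  variables and the formulas \<open>Just t A\<close> are atoms, with arbitrary independent truth values.
\<close>

primrec bool_eval ::
  "('p \<Rightarrow> bool) \<Rightarrow> (('c, 'v) tm \<Rightarrow> ('c, 'v, 'p) fm \<Rightarrow> bool) \<Rightarrow> ('c, 'v, 'p) fm \<Rightarrow> bool" where
  "bool_eval f g (PVar p) \<longleftrightarrow> f p"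
| "bool_eval f g Bot \<longleftrightarrow> False"
| "bool_eval f g (Neg A) \<longleftrightarrow> \<not> bool_eval f g A"
| "bool_eval f g (Con A B) \<longleftrightarrow> bool_eval f g A \<and> bool_eval f g B"
| "bool_eval f g (Dis A B) \<longleftrightarrow> bool_eval f g A \<or> bool_eval f g B"
| "bool_eval f g (Imp A B) \<longleftrightarrow> (bool_eval f g A \<longrightarrow> bool_eval f g B)"
| "bool_eval f g (Just t A) \<longleftrightarrow> g t A"

definition tautology :: "('c, 'v, 'p) fm \<Rightarrow> bool" where
  "tautology A \<longleftrightarrow> (\<forall>f g. bool_eval f g A)"

inductive axiom_scheme :: "logic \<Rightarrow> ('c, 'v, 'p) fm \<Rightarrow> bool" for L :: logic where
  "tautology A \<Longrightarrow> axiom_scheme L A"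
| "axiom_scheme L (Imp (Just s A) (Just (s \<oplus> t) A))"
| "axiom_scheme L (Imp (Just s A) (Just (t \<oplus> s) A))"
| "axiom_scheme L (Imp (Just s (Imp A B)) (Imp (Just t A) (Just (s \<cdot> t) B)))"
| "jT \<in> L \<Longrightarrow> axiom_scheme L (Imp (Just t A) A)"
| "jD \<in> L \<Longrightarrow> axiom_scheme L (Imp (Just t Bot) Bot)"
| "j4 \<in> L \<Longrightarrow> axiom_scheme L (Imp (Just t A) (Just (Bang t) (Just t A)))"
| "jB \<in> L \<Longrightarrow> axiom_scheme L (Imp (Neg A) (Just (BarQuest t) (Neg (Just t A))))"
| "j5 \<in> L \<Longrightarrow> axiom_scheme L (Imp (Neg (Just t A)) (Just (Quest t) (Neg (Just t A))))"

definition axiom_instance :: "logic \<Rightarrow> ('c, 'v, 'p) fm \<Rightarrow> bool" where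
  "axiom_instance L A \<longleftrightarrow> axiom_scheme L A \<and> fm_lang L A"

text \<open>\<open>just_consts [c\<^sub>n, \<dots>, c\<^sub>1] A\<close> is \<open>c\<^sub>n : \<dots> : c\<^sub>1 : A\<close>.\<close>

definition just_consts :: "'c list \<Rightarrow> ('c, 'v, 'p) fm \<Rightarrow> ('c, 'v, 'p) fm" where
  "just_consts cs A = foldr (\<lambda>c F. Just (JConst c) F) cs A"

definition constant_specification :: "logic \<Rightarrow> ('c, 'v, 'p) fm set \<Rightarrow> bool" where
  "constant_specification L CS \<longleftrightarrow>
     (if j4 \<in> L then
        (\<forall>F\<in>CS. \<exists>c A. axiom_instance L A \<and> F = Just (JConst c) A)
      else
        (\<forall>F\<in>CS. \<exists>cs A. cs \<noteq> [] \<and> axiom_instance L A \<and> F = just_consts cs A) \<and>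
        (\<forall>c cs A. cs \<noteq> [] \<and> axiom_instance L A \<and> just_consts (c # cs) A \<in> CS
           \<longrightarrow> just_consts cs A \<in> CS))"


type_synonym label = nat

datatype ('c, 'v, 'p) lform =
    Forces label "('c, 'v, 'p) fm"  (infix "\<tturnstile>" 65)
  | Rel label label
  | Evid label "('c, 'v) tm" "('c, 'v, 'p) fm"

datatype ('c, 'v, 'p) sequent =
  Seq "('c, 'v, 'p) lform multiset" "('c, 'v, 'p) lform multiset"  (infix "\<turnstile>" 55)

abbreviation mset_cons :: "'a \<Rightarrow> 'a multiset \<Rightarrow> 'a multiset"  (infixr ",," 60) where
  "x ,, M \<equiv> add_mset x M"

primrec lform_lang :: "logic \<Rightarrow> ('c, 'v, 'p) lform \<Rightarrow> bool" where
  "lform_lang L (w \<tturnstile> A) \<longleftrightarrow> fm_lang L A"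
| "lform_lang L (Rel w v) \<longleftrightarrow> True"
| "lform_lang L (Evid w t A) \<longleftrightarrow> tm_lang L t \<and> fm_lang L A"

primrec sequent_lang :: "logic \<Rightarrow> ('c, 'v, 'p) sequent \<Rightarrow> bool" where
  "sequent_lang L (\<Gamma> \<turnstile> \<Delta>) \<longleftrightarrow> (\<forall>\<phi> \<in># \<Gamma> + \<Delta>. lform_lang L \<phi>)"

primrec labels :: "('c, 'v, 'p) lform \<Rightarrow> label set" where
  "labels (w \<tturnstile> A) = {w}"
| "labels (Rel w v) = {w, v}"
| "labels (Evid w t A) = {w}"

primrec sequent_labels :: "('c, 'v, 'p) sequent \<Rightarrow> label set" where
  "sequent_labels (\<Gamma> \<turnstile> \<Delta>) = (\<Union>\<phi> \<in> set_mset (\<Gamma> + \<Delta>). labels \<phi>)"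

inductive initial :: "('c, 'v, 'p) sequent \<Rightarrow> bool" where
  "initial (w \<tturnstile> PVar p ,, \<Gamma> \<turnstile> w \<tturnstile> PVar p ,, \<Delta>)"
| "initial (w \<tturnstile> Bot ,, \<Gamma> \<turnstile> \<Delta>)"
| "initial (Rel w v ,, \<Gamma> \<turnstile> Rel w v ,, \<Delta>)"
| "initial (Evid w t A ,, \<Gamma> \<turnstile> Evid w t A ,, \<Delta>)"

text \<open>
  \<open>deriv L CS n S\<close>: there is a derivation of \<open>S\<close> of height exactly \<open>n\<close>. The
  restriction to the language of \<open>L\<close> is only imposed on initial sequents. In every rule the
  conclusion is in the language whenever the premises are, so all sequents of a derivation
  are in the language; see \<open>deriv_sequent_lang\<close> below.
\<close>

inductive deriv ::
  "logic \<Rightarrow> ('c, 'v, 'p) fm set \<Rightarrow> nat \<Rightarrow> ('c, 'v, 'p) sequent \<Rightarrow> bool"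
  for L :: logic and CS :: "('c, 'v, 'p) fm set"
where
  Init: "deriv L CS 0 S"
    if "initial S" "sequent_lang L S"
| LNeg: "deriv L CS (Suc n) (w \<tturnstile> Neg A ,, \<Gamma> \<turnstile> \<Delta>)"
    if "deriv L CS n (\<Gamma> \<turnstile> w \<tturnstile> A ,, \<Delta>)"
| RNeg: "deriv L CS (Suc n) (\<Gamma> \<turnstile> w \<tturnstile> Neg A ,, \<Delta>)"
    if "deriv L CS n (w \<tturnstile> A ,, \<Gamma> \<turnstile> \<Delta>)"
| LCon: "deriv L CS (Suc n) (w \<tturnstile> Con A B ,, \<Gamma> \<turnstile> \<Delta>)"
    if "deriv L CS n (w \<tturnstile> A ,, w \<tturnstile> B ,, \<Gamma> \<turnstile> \<Delta>)"
| RCon: "deriv L CS (Suc (max m n)) (\<Gamma> \<turnstile> w \<tturnstile> Con A B ,, \<Delta>)"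
    if "deriv L CS m (\<Gamma> \<turnstile> w \<tturnstile> A ,, \<Delta>)" "deriv L CS n (\<Gamma> \<turnstile> w \<tturnstile> B ,, \<Delta>)"
| LDis: "deriv L CS (Suc (max m n)) (w \<tturnstile> Dis A B ,, \<Gamma> \<turnstile> \<Delta>)"
    if "deriv L CS m (w \<tturnstile> A ,, \<Gamma> \<turnstile> \<Delta>)" "deriv L CS n (w \<tturnstile> B ,, \<Gamma> \<turnstile> \<Delta>)"
| RDis: "deriv L CS (Suc n) (\<Gamma> \<turnstile> w \<tturnstile> Dis A B ,, \<Delta>)"
    if "deriv L CS n (\<Gamma> \<turnstile> w \<tturnstile> A ,, w \<tturnstile> B ,, \<Delta>)"
| LImp: "deriv L CS (Suc (max m n)) (w \<tturnstile> Imp A B ,, \<Gamma> \<turnstile> \<Delta>)"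
    if "deriv L CS m (\<Gamma> \<turnstile> w \<tturnstile> A ,, \<Delta>)" "deriv L CS n (w \<tturnstile> B ,, \<Gamma> \<turnstile> \<Delta>)"
| RImp: "deriv L CS (Suc n) (\<Gamma> \<turnstile> w \<tturnstile> Imp A B ,, \<Delta>)"
    if "deriv L CS n (w \<tturnstile> A ,, \<Gamma> \<turnstile> w \<tturnstile> B ,, \<Delta>)"
| LJust: "deriv L CS (Suc n) (w \<tturnstile> Just t A ,, Rel w v ,, \<Gamma> \<turnstile> \<Delta>)"
    if "deriv L CS n (v \<tturnstile> A ,, w \<tturnstile> Just t A ,, Rel w v ,, \<Gamma> \<turnstile> \<Delta>)"
| RJust: "deriv L CS (Suc n) (Evid w t A ,, \<Gamma> \<turnstile> w \<tturnstile> Just t A ,, \<Delta>)"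
    if "deriv L CS n (Rel w v ,, Evid w t A ,, \<Gamma> \<turnstile> v \<tturnstile> A ,, \<Delta>)"
       "v \<notin> sequent_labels (Evid w t A ,, \<Gamma> \<turnstile> w \<tturnstile> Just t A ,, \<Delta>)"
| E: "deriv L CS (Suc n) (w \<tturnstile> Just t A ,, \<Gamma> \<turnstile> \<Delta>)"
    if "deriv L CS n (Evid w t A ,, w \<tturnstile> Just t A ,, \<Gamma> \<turnstile> \<Delta>)"
| ElPlus: "deriv L CS (Suc n) (Evid w t A ,, \<Gamma> \<turnstile> \<Delta>)"
    if "deriv L CS n (Evid w (s \<oplus> t) A ,, Evid w t A ,, \<Gamma> \<turnstile> \<Delta>)"
| ErPlus: "deriv L CS (Suc n) (Evid w t A ,, \<Gamma> \<turnstile> \<Delta>)"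
    if "deriv L CS n (Evid w (t \<oplus> s) A ,, Evid w t A ,, \<Gamma> \<turnstile> \<Delta>)"
| EApp: "deriv L CS (Suc n) (Evid w s (Imp A B) ,, Evid w t A ,, \<Gamma> \<turnstile> \<Delta>)"
    if "deriv L CS n (Evid w (s \<cdot> t) B ,, Evid w s (Imp A B) ,, Evid w t A ,, \<Gamma> \<turnstile> \<Delta>)"
| AN: "deriv L CS (Suc n) (\<Gamma> \<turnstile> \<Delta>)"
    if "Just (JConst c) F \<in> CS" "deriv L CS n (Evid w (JConst c) F ,, \<Gamma> \<turnstile> \<Delta>)"
| Ref: "deriv L CS (Suc n) (\<Gamma> \<turnstile> \<Delta>)"
    if "jT \<in> L" "deriv L CS n (Rel w w ,, \<Gamma> \<turnstile> \<Delta>)"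
| Ser: "deriv L CS (Suc n) (\<Gamma> \<turnstile> \<Delta>)"
    if "jD \<in> L" "deriv L CS n (Rel w v ,, \<Gamma> \<turnstile> \<Delta>)" "v \<notin> sequent_labels (\<Gamma> \<turnstile> \<Delta>)"
| EBang: "deriv L CS (Suc n) (Evid w t A ,, \<Gamma> \<turnstile> \<Delta>)"
    if "j4 \<in> L" "deriv L CS n (Evid w (Bang t) (Just t A) ,, Evid w t A ,, \<Gamma> \<turnstile> \<Delta>)"
| Mon: "deriv L CS (Suc n) (Evid w t A ,, Rel w v ,, \<Gamma> \<turnstile> \<Delta>)"
    if "j4 \<in> L" "deriv L CS n (Evid v t A ,, Evid w t A ,, Rel w v ,, \<Gamma> \<turnstile> \<Delta>)"
| Trans: "deriv L CS (Suc n) (Rel w v ,, Rel v u ,, \<Gamma> \<turnstile> \<Delta>)"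
    if "j4 \<in> L" "deriv L CS n (Rel w u ,, Rel w v ,, Rel v u ,, \<Gamma> \<turnstile> \<Delta>)"
| EBarQuest: "deriv L CS (Suc (max m n)) (\<Gamma> \<turnstile> \<Delta>)"
    if "jB \<in> L" "deriv L CS m (w \<tturnstile> A ,, \<Gamma> \<turnstile> \<Delta>)"
       "deriv L CS n (Evid w (BarQuest t) (Neg (Just t A)) ,, \<Gamma> \<turnstile> \<Delta>)"
| Sym: "deriv L CS (Suc n) (Rel w v ,, \<Gamma> \<turnstile> \<Delta>)"
    if "jB \<in> L" "deriv L CS n (Rel v w ,, Rel w v ,, \<Gamma> \<turnstile> \<Delta>)"
| SE: "deriv L CS (Suc n) (Evid w t A ,, \<Gamma> \<turnstile> \<Delta>)"
    if "j5 \<in> L" "deriv L CS n (w \<tturnstile> Just t A ,, Evid w t A ,, \<Gamma> \<turnstile> \<Delta>)"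
| EQuest: "deriv L CS (Suc (max m n)) (\<Gamma> \<turnstile> \<Delta>)"
    if "j5 \<in> L" "deriv L CS m (Evid w t A ,, \<Gamma> \<turnstile> \<Delta>)"
       "deriv L CS n (Evid w (Quest t) (Neg (Just t A)) ,, \<Gamma> \<turnstile> \<Delta>)"

lemma deriv_sequent_lang: "deriv L CS n S \<Longrightarrow> sequent_lang L S"
  by (induction rule: deriv.induct) auto

definition derivable_height ::
  "logic \<Rightarrow> ('c, 'v, 'p) fm set \<Rightarrow> nat \<Rightarrow> ('c, 'v, 'p) sequent \<Rightarrow> bool" where
  "derivable_height L CS n S \<longleftrightarrow> (\<exists>m\<le>n. deriv L CS m S)"


text \<open>A rule is the set of its instances, each a list of premises with a conclusion.\<close>

type_synonym ('c, 'v, 'p) seq_rule = "(('c, 'v, 'p) sequent list \<times> ('c, 'v, 'p) sequent) set"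

definition hp_CS_admissible ::
  "logic \<Rightarrow> ('c, 'v, 'p) fm set \<Rightarrow> ('c, 'v, 'p) seq_rule \<Rightarrow> bool" where
  "hp_CS_admissible L CS R \<longleftrightarrow>
     (\<forall>(Ps, C) \<in> R. \<forall>n. (\<forall>P \<in> set Ps. derivable_height L CS n P) \<longrightarrow> derivable_height L CS n C)"

definition LC :: "('c, 'v, 'p) seq_rule" where
  "LC = {([\<phi> ,, \<phi> ,, \<Gamma> \<turnstile> \<Delta>], \<phi> ,, \<Gamma> \<turnstile> \<Delta>) | \<phi> \<Gamma> \<Delta>. True}"

definition RC :: "('c, 'v, 'p) seq_rule" where
  "RC = {([\<Gamma> \<turnstile> \<phi> ,, \<phi> ,, \<Delta>], \<Gamma> \<turnstile> \<phi> ,, \<Delta>) | \<phi> \<Gamma> \<Delta>. True}"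

end

theory Submission
  imports Defs
begin

text \<open>
  Contraction is proved by induction on the height of the derivation of the premise, for all
  contracted formulas at once. Only the last rule can cause trouble, when one of the two copies
  is principal in it, and the rules of the calculus fall into two kinds.

  Most rules only add formulas to the antecedent of their premises and keep everything that they
  look at. Both copies of the contracted formula are then still present in every premise, the
  induction hypothesis removes one of them, and the rule is applied again. This fails only if
  the rule looks at both copies. Transitivity applied to \<open>wRw, wRw\<close> is the one such case (the
  evidence rule for application would need \<open>A = A \<rightarrow> B\<close>). It adds a third \<open>wRw\<close>, so that
  contracting its premise twice yields the desired sequent outright.

  The other rules replace a compound formula by parts of it. These rules are invertible without
  increase of height (\<open>inversion\<close>), so the second copy, which survives in the premises, can be
  replaced by the same parts; the induction hypothesis merges the two families of parts, and the
  rule is applied again. The rule for \<open>t : A\<close> in the succedent belongs to this kind: its inverse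
  adds \<open>wRv\<close> and \<open>v \<tturnstile> A\<close> for a label \<open>v\<close> of choice, and choosing the eigenlabel of the last
  rule makes the two families coincide. The evidence atom that this rule looks at is kept,
  as in the rules of the first kind.

  Invertibility rests on the possibility of renaming labels and weakening without increase of
  height (\<open>bounded_relabel_weaken\<close>), which makes eigenlabels as fresh as desired.

  To carry out these arguments once rather than once per rule and side, a sequent is represented
  by a single multiset of formulas tagged with their side, and all rules are instances of one
  pattern (\<open>scheme\<close>). The properties of the rules that the induction uses are then few:
  closure under renaming, and the lemmas \<open>scheme_principal\<close> to \<open>scheme_instantiate\<close>.
\<close>

section \<open>Sequents as multisets of signed formulas\<close>

text \<open>
  The left summand marks the formulas of the antecedent, the right summand those of the succedent.
  With both sides in one multiset, left and right contraction become the same rule.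
\<close>

type_synonym ('c, 'v, 'p) signed = "('c, 'v, 'p) lform + ('c, 'v, 'p) lform"

definition body :: "'a + 'a \<Rightarrow> 'a" where
  "body = case_sum (\<lambda>x. x) (\<lambda>x. x)"

lemma body_simps [simp]: "body (Inl x) = x" "body (Inr x) = x"
  by (simp_all add: body_def)

definition merge :: "('c, 'v, 'p) sequent \<Rightarrow> ('c, 'v, 'p) signed multiset" where
  "merge S = (case S of \<Gamma> \<turnstile> \<Delta> \<Rightarrow> image_mset Inl \<Gamma> + image_mset Inr \<Delta>)"

definition unmerge :: "('c, 'v, 'p) signed multiset \<Rightarrow> ('c, 'v, 'p) sequent" where
  "unmerge M = (image_mset body (filter_mset isl M) \<turnstile> image_mset body (filter_mset (\<lambda>x. \<not> isl x) M))"

lemma unmerge_merge: "unmerge (merge S) = S"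
proof (cases S)
  case (Seq \<Gamma> \<Delta>)
  have "image_mset body (image_mset Inl \<Gamma>) = \<Gamma>" "image_mset body (image_mset Inr \<Delta>) = \<Delta>"
    by (simp_all add: image_mset.compositionality comp_def)
  with Seq show ?thesis by (simp add: unmerge_def merge_def filter_mset_image_mset comp_def)
qed

definition in_lang :: "logic \<Rightarrow> ('c, 'v, 'p) signed multiset \<Rightarrow> bool" where
  "in_lang L M \<longleftrightarrow> (\<forall>x\<in>#M. lform_lang L (body x))"

definition labs :: "('c, 'v, 'p) signed multiset \<Rightarrow> label set" where
  "labs M = (\<Union>x\<in>set_mset M. labels (body x))"

lemma in_lang_simps [simp]:
  "in_lang L {#}"
  "in_lang L (add_mset x M) \<longleftrightarrow> lform_lang L (body x) \<and> in_lang L M"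
  "in_lang L (M + N) \<longleftrightarrow> in_lang L M \<and> in_lang L N"
  by (auto simp: in_lang_def)

lemma labs_simps [simp]:
  "labs {#} = {}"
  "labs (add_mset x M) = labels (body x) \<union> labs M"
  "labs (M + N) = labs M \<union> labs N"
  by (auto simp: labs_def)

lemma finite_labs [simp]:
  fixes M :: "('c, 'v, 'p) signed multiset"
  shows "finite (labs M)"
proof -
  have "finite (labels \<phi>)" for \<phi> :: "('c, 'v, 'p) lform" by (cases \<phi>) auto
  then show ?thesis by (auto simp: labs_def)
qed

lemma in_lang_unmerge: "sequent_lang L (unmerge M) \<longleftrightarrow> in_lang L M"
  by (auto simp: unmerge_def in_lang_def)

lemma labs_unmerge: "sequent_labels (unmerge M) = labs M"
  by (auto simp: unmerge_def labs_def)

text \<open>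
  Initial sequents, described by membership alone: this form is evidently insensitive to
  contraction and stable under weakening.
\<close>

definition axiomatic :: "('c, 'v, 'p) signed multiset \<Rightarrow> bool" where
  "axiomatic M \<longleftrightarrow> (\<exists>w. Inl (w \<tturnstile> Bot) \<in># M) \<or>
     (\<exists>\<phi>. Inl \<phi> \<in># M \<and> Inr \<phi> \<in># M \<and>
       (case \<phi> of w \<tturnstile> A \<Rightarrow> (\<exists>p. A = PVar p) | _ \<Rightarrow> True))"

lemma axiomatic_unmerge: "initial (unmerge M) \<longleftrightarrow> axiomatic M"
proof
  have mem: "Inl \<phi> \<in># M" if "image_mset body (filter_mset isl M) = add_mset \<phi> \<Gamma>" for \<phi> \<Gamma>
  proof -
    have "\<phi> \<in># image_mset body (filter_mset isl M)" by (simp add: that)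
    then obtain x where "x \<in># M" "isl x" "\<phi> = body x" by auto
    then show ?thesis by (cases x) auto
  qed
  have mem': "Inr \<phi> \<in># M"
    if "image_mset body (filter_mset (\<lambda>x. \<not> isl x) M) = add_mset \<phi> \<Delta>" for \<phi> \<Delta>
  proof -
    have "\<phi> \<in># image_mset body (filter_mset (\<lambda>x. \<not> isl x) M)" by (simp add: that)
    then obtain x where "x \<in># M" "\<not> isl x" "\<phi> = body x" by auto
    then show ?thesis by (cases x) auto
  qed
  assume "initial (unmerge M)"
  then show "axiomatic M"
    unfolding unmerge_def axiomatic_def
    by cases (auto dest!: mem mem' split: lform.splits)
next
  assume "axiomatic M"
  then consider w where "Inl (w \<tturnstile> Bot) \<in># M"
    | \<phi> where "Inl \<phi> \<in># M" "Inr \<phi> \<in># M"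
        "case \<phi> of w \<tturnstile> A \<Rightarrow> (\<exists>p. A = PVar p) | _ \<Rightarrow> True"
    by (auto simp: axiomatic_def)
  then show "initial (unmerge M)"
  proof cases
    case 1
    then obtain N where "M = add_mset (Inl (w \<tturnstile> Bot)) N" by (metis insert_DiffM)
    then show ?thesis by (simp add: unmerge_def initial.intros)
  next
    case 2
    then obtain N where N: "M = add_mset (Inl \<phi>) (add_mset (Inr \<phi>) N)"
      by (metis insert_DiffM insert_noteq_member sum.distinct(1))
    show ?thesis using 2(3) by (cases \<phi>) (auto simp: N unmerge_def intro: initial.intros)
  qed
qed

section \<open>One pattern for all rules\<close>

text \<open>
  The invertible ways of replacing a compound formula: each element of \<open>parts x\<close> may replace
  \<open>x\<close> in a derivable sequent. For \<open>t : A\<close> in the succedent there is one replacement for each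
  label, although a rule application uses only one of them, with an eigenlabel.
  On the left, \<open>t : A\<close> has no parts because the rules for it keep it.
\<close>

fun parts :: "('c, 'v, 'p) signed \<Rightarrow> ('c, 'v, 'p) signed multiset set" where
  "parts (Inl (w \<tturnstile> Neg A)) = {{#Inr (w \<tturnstile> A)#}}"
| "parts (Inr (w \<tturnstile> Neg A)) = {{#Inl (w \<tturnstile> A)#}}"
| "parts (Inl (w \<tturnstile> Con A B)) = {{#Inl (w \<tturnstile> A), Inl (w \<tturnstile> B)#}}"
| "parts (Inr (w \<tturnstile> Con A B)) = {{#Inr (w \<tturnstile> A)#}, {#Inr (w \<tturnstile> B)#}}"
| "parts (Inl (w \<tturnstile> Dis A B)) = {{#Inl (w \<tturnstile> A)#}, {#Inl (w \<tturnstile> B)#}}"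
| "parts (Inr (w \<tturnstile> Dis A B)) = {{#Inr (w \<tturnstile> A), Inr (w \<tturnstile> B)#}}"
| "parts (Inl (w \<tturnstile> Imp A B)) = {{#Inr (w \<tturnstile> A)#}, {#Inl (w \<tturnstile> B)#}}"
| "parts (Inr (w \<tturnstile> Imp A B)) = {{#Inl (w \<tturnstile> A), Inr (w \<tturnstile> B)#}}"
| "parts (Inr (w \<tturnstile> Just t A)) = range (\<lambda>v. {#Inl (Rel w v), Inr (v \<tturnstile> A)#})"
| "parts _ = {}"

fun right_just :: "('c, 'v, 'p) signed \<Rightarrow> bool" where
  "right_just (Inr (w \<tturnstile> Just t A)) = True"
| "right_just _ = False"

text \<open>
  \<open>scheme L CS K X Cs V\<close> stands for the rule with conclusion \<open>X + G\<close> and premises \<open>C + G\<close>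
  for \<open>C \<in> Cs\<close>, where the context \<open>G\<close> must contain \<open>K\<close> and the labels in \<open>V\<close> must not occur in
  the conclusion. Thus \<open>X\<close> is what the rule consumes and \<open>K\<close> what it looks at and keeps.
  The propositional rules have all parts of the principal formula as premises. This does not make
  sense for \<open>t : A\<close> in the succedent, where a single part with an eigenlabel stands for all.
\<close>

inductive scheme ::
  "logic \<Rightarrow> ('c, 'v, 'p) fm set \<Rightarrow> ('c, 'v, 'p) signed multiset \<Rightarrow> ('c, 'v, 'p) signed multiset \<Rightarrow>
   ('c, 'v, 'p) signed multiset set \<Rightarrow> label set \<Rightarrow> bool"
  for L :: logic and CS :: "('c, 'v, 'p) fm set"
where
  s_prop: "parts x \<noteq> {} \<Longrightarrow> \<not> right_just x \<Longrightarrow> scheme L CS {#} {#x#} (parts x) {}"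
| s_RJust: "scheme L CS {#Inl (Evid w t A)#} {#Inr (w \<tturnstile> Just t A)#}
     {{#Inl (Rel w v), Inr (v \<tturnstile> A)#}} {v}"
| s_LJust: "scheme L CS {#Inl (w \<tturnstile> Just t A), Inl (Rel w v)#} {#} {{#Inl (v \<tturnstile> A)#}} {}"
| s_E: "scheme L CS {#Inl (w \<tturnstile> Just t A)#} {#} {{#Inl (Evid w t A)#}} {}"
| s_ElPlus: "scheme L CS {#Inl (Evid w t A)#} {#} {{#Inl (Evid w (s \<oplus> t) A)#}} {}"
| s_ErPlus: "scheme L CS {#Inl (Evid w t A)#} {#} {{#Inl (Evid w (t \<oplus> s) A)#}} {}"
| s_EApp: "scheme L CS {#Inl (Evid w s (Imp A B)), Inl (Evid w t A)#} {#}
     {{#Inl (Evid w (s \<cdot> t) B)#}} {}"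
| s_AN: "Just (JConst c) F \<in> CS \<Longrightarrow> scheme L CS {#} {#} {{#Inl (Evid w (JConst c) F)#}} {}"
| s_Ref: "jT \<in> L \<Longrightarrow> scheme L CS {#} {#} {{#Inl (Rel w w)#}} {}"
| s_Ser: "jD \<in> L \<Longrightarrow> scheme L CS {#} {#} {{#Inl (Rel w v)#}} {v}"
| s_EBang: "j4 \<in> L \<Longrightarrow>
     scheme L CS {#Inl (Evid w t A)#} {#} {{#Inl (Evid w (Bang t) (Just t A))#}} {}"
| s_Mon: "j4 \<in> L \<Longrightarrow>
     scheme L CS {#Inl (Evid w t A), Inl (Rel w v)#} {#} {{#Inl (Evid v t A)#}} {}"
| s_Trans: "j4 \<in> L \<Longrightarrow> scheme L CS {#Inl (Rel w v), Inl (Rel v u)#} {#} {{#Inl (Rel w u)#}} {}"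
| s_EBarQuest: "jB \<in> L \<Longrightarrow> scheme L CS {#} {#}
     {{#Inl (w \<tturnstile> A)#}, {#Inl (Evid w (BarQuest t) (Neg (Just t A)))#}} {}"
| s_Sym: "jB \<in> L \<Longrightarrow> scheme L CS {#Inl (Rel w v)#} {#} {{#Inl (Rel v w)#}} {}"
| s_SE: "j5 \<in> L \<Longrightarrow> scheme L CS {#Inl (Evid w t A)#} {#} {{#Inl (w \<tturnstile> Just t A)#}} {}"
| s_EQuest: "j5 \<in> L \<Longrightarrow> scheme L CS {#} {#}
     {{#Inl (Evid w t A)#}, {#Inl (Evid w (Quest t) (Neg (Just t A)))#}} {}"

text \<open>
  Derivability with height at most \<open>n\<close>, rather than exactly \<open>n\<close>: all premises of a rule then
  have the same bound.
\<close>

inductive bounded ::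
  "logic \<Rightarrow> ('c, 'v, 'p) fm set \<Rightarrow> nat \<Rightarrow> ('c, 'v, 'p) signed multiset \<Rightarrow> bool"
  for L :: logic and CS :: "('c, 'v, 'p) fm set"
where
  b_axiom: "axiomatic M \<Longrightarrow> in_lang L M \<Longrightarrow> bounded L CS n M"
| b_step: "scheme L CS K X Cs V \<Longrightarrow> K \<subseteq># G \<Longrightarrow> (\<And>C. C \<in> Cs \<Longrightarrow> bounded L CS n (C + G)) \<Longrightarrow>
     V \<inter> labs (X + G) = {} \<Longrightarrow> bounded L CS (Suc n) (X + G)"

lemma bounded_mono: "bounded L CS m M \<Longrightarrow> m \<le> n \<Longrightarrow> bounded L CS n M"
proof (induction arbitrary: n rule: bounded.induct)
  case (b_axiom M m)
  then show ?case by (simp add: bounded.b_axiom)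
next
  case (b_step K X Cs V G m)
  then obtain k where "n = Suc k" "m \<le> k" by (cases n) auto
  then show ?case using b_step bounded.b_step by blast
qed

section \<open>Renaming of labels and weakening\<close>

primrec relabel :: "(label \<Rightarrow> label) \<Rightarrow> ('c, 'v, 'p) lform \<Rightarrow> ('c, 'v, 'p) lform" where
  "relabel \<sigma> (w \<tturnstile> A) = (\<sigma> w \<tturnstile> A)"
| "relabel \<sigma> (Rel w v) = Rel (\<sigma> w) (\<sigma> v)"
| "relabel \<sigma> (Evid w t A) = Evid (\<sigma> w) t A"

abbreviation srelabel :: "(label \<Rightarrow> label) \<Rightarrow> ('c, 'v, 'p) signed \<Rightarrow> ('c, 'v, 'p) signed" where
  "srelabel \<sigma> \<equiv> map_sum (relabel \<sigma>) (relabel \<sigma>)"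

abbreviation mrelabel ::
  "(label \<Rightarrow> label) \<Rightarrow> ('c, 'v, 'p) signed multiset \<Rightarrow> ('c, 'v, 'p) signed multiset" where
  "mrelabel \<sigma> \<equiv> image_mset (srelabel \<sigma>)"

lemma relabel_cong: "(\<And>w. w \<in> labels \<phi> \<Longrightarrow> \<sigma> w = \<tau> w) \<Longrightarrow> relabel \<sigma> \<phi> = relabel \<tau> \<phi>"
  by (cases \<phi>) auto

lemma mrelabel_cong:
  assumes "\<And>w. w \<in> labs M \<Longrightarrow> \<sigma> w = \<tau> w"
  shows "mrelabel \<sigma> M = mrelabel \<tau> M"
proof (rule image_mset_cong)
  fix x assume "x \<in># M"
  then have "relabel \<sigma> (body x) = relabel \<tau> (body x)"
    using assms by (intro relabel_cong) (auto simp: labs_def)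
  then show "srelabel \<sigma> x = srelabel \<tau> x" by (cases x) auto
qed

lemma mrelabel_ident:
  fixes M :: "('c, 'v, 'p) signed multiset"
  assumes "\<And>w. w \<in> labs M \<Longrightarrow> \<sigma> w = w"
  shows "mrelabel \<sigma> M = M"
proof -
  have "relabel (\<lambda>w. w) \<phi> = \<phi>" for \<phi> :: "('c, 'v, 'p) lform" by (cases \<phi>) auto
  then have "relabel (\<lambda>w. w) = (\<lambda>\<phi> :: ('c, 'v, 'p) lform. \<phi>)" by auto
  then have "mrelabel (\<lambda>w. w) M = M" by (simp add: sum.map_id0[unfolded id_def])
  then show ?thesis using mrelabel_cong[of M \<sigma> "\<lambda>w. w"] assms by simp
qed

lemma in_lang_mrelabel: "in_lang L M \<Longrightarrow> in_lang L (mrelabel \<sigma> M)"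
proof (induction M)
  case (add x M)
  have "lform_lang L (relabel \<sigma> \<phi>) = lform_lang L \<phi>" for \<phi> :: "('a, 'b, 'c) lform"
    by (cases \<phi>) auto
  then show ?case using add by (cases x) auto
qed simp

lemma axiomatic_mono: "axiomatic M \<Longrightarrow> set_mset M \<subseteq> set_mset N \<Longrightarrow> axiomatic N"
  unfolding axiomatic_def by blast

lemma axiomatic_mrelabel:
  assumes "axiomatic M"
  shows "axiomatic (mrelabel \<sigma> M)"
proof -
  have mem: "srelabel \<sigma> x \<in># mrelabel \<sigma> M" if "x \<in># M" for x using that by simp
  from assms consider w where "Inl (w \<tturnstile> Bot) \<in># M"
    | \<phi> where "Inl \<phi> \<in># M" "Inr \<phi> \<in># M"
        "case \<phi> of w \<tturnstile> A \<Rightarrow> (\<exists>p. A = PVar p) | _ \<Rightarrow> True"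
    by (auto simp: axiomatic_def)
  then show ?thesis
  proof cases
    case 1
    from mem[OF 1] show ?thesis unfolding axiomatic_def by auto
  next
    case 2
    from 2(3) have "case relabel \<sigma> \<phi> of w \<tturnstile> A \<Rightarrow> (\<exists>p. A = PVar p) | _ \<Rightarrow> True"
      by (cases \<phi>) auto
    with mem[OF 2(1)] mem[OF 2(2)] show ?thesis unfolding axiomatic_def by auto
  qed
qed

lemma scheme_relabel:
  assumes "scheme L CS K X Cs V"
  shows "scheme L CS (mrelabel \<sigma> K) (mrelabel \<sigma> X) (mrelabel \<sigma> ` Cs) (\<sigma> ` V)"
  using assms
proof cases
  case (s_prop x)
  have "parts (srelabel \<sigma> x) = mrelabel \<sigma> ` parts x" "\<not> right_just (srelabel \<sigma> x)"
    using \<open>\<not> right_just x\<close> by (cases x rule: parts.cases; simp)+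
  with scheme.s_prop[of "srelabel \<sigma> x" L CS] s_prop show ?thesis by simp
qed (auto intro: scheme.intros)

text \<open>
  Renaming and weakening are proved in one induction. Each of them can clash with the eigenlabels
  of a rule, and both clashes are repaired by modifying the renaming, which the induction
  hypothesis permits. The renaming may be arbitrary, not only injective.
\<close>

theorem bounded_relabel_weaken:
  "bounded L CS n M \<Longrightarrow> in_lang L N \<Longrightarrow> bounded L CS n (mrelabel \<sigma> M + N)"
proof (induction arbitrary: \<sigma> rule: bounded.induct)
  case (b_axiom M n)
  then have "axiomatic (mrelabel \<sigma> M + N)"
    using axiomatic_mono[OF axiomatic_mrelabel[of M \<sigma>], of "mrelabel \<sigma> M + N"] by simp
  with b_axiom show ?case by (simp add: bounded.b_axiom in_lang_mrelabel)
next
  case (b_step K X Cs V G n)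
  obtain v where v: "v \<notin> labs (mrelabel \<sigma> (X + G) + N)"
    by (meson ex_new_if_finite finite_labs infinite_UNIV_nat)
  \<comment> \<open>Eigenlabels do not occur in the conclusion, so there \<open>\<tau>\<close> acts like \<open>\<sigma>\<close>.\<close>
  define \<tau> where "\<tau> = (\<lambda>w. if w \<in> V then v else \<sigma> w)"
  have X: "mrelabel \<tau> X = mrelabel \<sigma> X" and G: "mrelabel \<tau> G = mrelabel \<sigma> G"
    using b_step.hyps(4) by (auto intro!: mrelabel_cong simp: \<tau>_def)
  have "bounded L CS (Suc n) (mrelabel \<tau> X + (mrelabel \<tau> G + N))"
  proof (rule bounded.b_step[OF scheme_relabel[OF b_step.hyps(1)]])
    show "mrelabel \<tau> K \<subseteq># mrelabel \<tau> G + N"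
      using b_step.hyps(2) by (simp add: image_mset_subseteq_mono subset_mset.add_increasing2)
    show "\<tau> ` V \<inter> labs (mrelabel \<tau> X + (mrelabel \<tau> G + N)) = {}"
      unfolding X G using v by (auto simp: \<tau>_def)
    show "bounded L CS n (C + (mrelabel \<tau> G + N))" if "C \<in> mrelabel \<tau> ` Cs" for C
      using that b_step by (auto simp: add.assoc[symmetric] simp flip: image_mset_union)
  qed
  then show ?case by (simp add: X G add.assoc)
qed

text \<open>
  Case analysis on the last rule, with eigenlabels avoiding any given finite set: rename them in
  the premises.
\<close>

lemma bounded_fresh_cases:
  assumes "bounded L CS n M" and "finite F"
  obtains (axiomatic) "axiomatic M" "in_lang L M"
  | (step) k K X Cs V G where "n = Suc k" "M = X + G" "scheme L CS K X Cs V" "K \<subseteq># G"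
      "\<And>C. C \<in> Cs \<Longrightarrow> bounded L CS k (C + G)" "V \<inter> (labs (X + G) \<union> F) = {}"
  using assms(1)
proof cases
  case b_axiom
  then show ?thesis by (rule axiomatic)
next
  case (b_step K X Cs V G k)
  obtain v where v: "v \<notin> labs (X + G) \<union> F"
    by (meson assms(2) ex_new_if_finite finite_UnI finite_labs infinite_UNIV_nat)
  define \<tau> where "\<tau> = (\<lambda>w. if w \<in> V then v else w)"
  have X: "mrelabel \<tau> X = X" and G: "mrelabel \<tau> G = G"
    using b_step(6) by (auto intro!: mrelabel_ident simp: \<tau>_def)
  show ?thesis
  proof (rule step)
    show "n = Suc k" "M = X + G" using b_step by simp_all
    show "scheme L CS (mrelabel \<tau> K) X (mrelabel \<tau> ` Cs) (\<tau> ` V)"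
      using scheme_relabel[OF b_step(3), of \<tau>] by (simp add: X)
    show "mrelabel \<tau> K \<subseteq># G" 
      using b_step image_mset_subseteq_mono[of K G "srelabel \<tau>"] by (simp add: G)
    show "bounded L CS k (C + G)" if "C \<in> mrelabel \<tau> ` Cs" for C
      using that bounded_relabel_weaken[OF b_step(5), of _ "{#}" \<tau>] by (auto simp: G)
    show "\<tau> ` V \<inter> (labs (X + G) \<union> F) = {}"
      using v by (auto simp: \<tau>_def)
  qed
qed

section \<open>Inversion\<close>

lemma subseteq_add_mset_notin:
  assumes "x \<notin># K" and "K \<subseteq># add_mset x M"
  shows "K \<subseteq># M"
proof (rule mset_subset_eqI)
  have x: "count K x = 0" using assms(1) by (simp add: not_in_iff)
  fix y
  have "count K y \<le> count (add_mset x M) y" by (rule mset_subset_eq_count[OF assms(2)])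
  then show "count K y \<le> count M y" 
    using x by (cases "y = x"; simp split: if_splits)
qed

lemma scheme_principal:
  "scheme L CS K X Cs V \<Longrightarrow> X = {#} \<or> (\<exists>x. X = {#x#} \<and> Cs \<subseteq> parts x)"
  by (induction rule: scheme.induct) auto

lemma scheme_nonempty: "scheme L CS K X Cs V \<Longrightarrow> Cs \<noteq> {}"
  by (induction rule: scheme.induct) auto

lemma scheme_kept: "scheme L CS K X Cs V \<Longrightarrow> x \<in># K \<Longrightarrow> parts x = {}"
  by (induction rule: scheme.induct) auto

text \<open>
  Only transitivity from \<open>wRw\<close> and \<open>wRw\<close> looks at two copies of one formula, and what it adds
  is a further copy.
\<close>

lemma scheme_kept_twice: "scheme L CS K X Cs V \<Longrightarrow> count K x \<ge> 2 \<Longrightarrow> X = {#} \<and> {#x#} \<in> Cs"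
  by (induction rule: scheme.induct) (auto split: if_splits)

text \<open>
  Every part of a principal formula is obtained from a premise of the rule by instantiating the
  eigenlabels. For the propositional rules the part is itself a premise; for \<open>t : A\<close> in the
  succedent the eigenlabel is sent to the label of the part.
\<close>

lemma scheme_instantiate:
  assumes "scheme L CS K {#x#} Cs V" and "V \<inter> labels (body x) = {}" and "C \<in> parts x"
  obtains \<sigma> C' where "C' \<in> Cs" "mrelabel \<sigma> C' = C" "\<And>w. w \<notin> V \<Longrightarrow> \<sigma> w = w"
  using assms(1)
proof cases
  case s_prop
  have "mrelabel (\<lambda>w. w) C = C" by (rule mrelabel_ident) simp
  with s_prop assms(3) that[of C "\<lambda>w. w"] show ?thesis by simp
next
  case (s_RJust w t A v)
  with assms(3) obtain u where "C = {#Inl (Rel w u), Inr (u \<tturnstile> A)#}" by auto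
  with s_RJust assms(2) show ?thesis
    by (intro that[of "{#Inl (Rel w v), Inr (v \<tturnstile> A)#}" "\<lambda>z. if z = v then u else z"]) auto
qed simp_all

lemma parts_lang: "C \<in> parts x \<Longrightarrow> lform_lang L (body x) \<Longrightarrow> in_lang L C"
  by (cases x rule: parts.cases) auto

text \<open>
  Formulas with parts are compound, whereas a sequent is initial because of propositional variables,
  \<open>\<bottom>\<close>, relational atoms or evidence atoms.
\<close>

lemma axiomatic_remove:
  assumes "axiomatic (add_mset x M)" and "parts x \<noteq> {}"
  shows "axiomatic M"
proof -
  from assms(1) consider w where "Inl (w \<tturnstile> Bot) \<in># add_mset x M"
    | \<phi> where "Inl \<phi> \<in># add_mset x M" "Inr \<phi> \<in># add_mset x M"
        "case \<phi> of w \<tturnstile> A \<Rightarrow> (\<exists>p. A = PVar p) | _ \<Rightarrow> True"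
    unfolding axiomatic_def by blast
  then show ?thesis
  proof cases
    case 1
    moreover have "x \<noteq> Inl (w \<tturnstile> Bot)" using assms(2) by auto
    ultimately show ?thesis by (auto simp: axiomatic_def)
  next
    case 2
    moreover have "x \<noteq> Inl \<phi>" "x \<noteq> Inr \<phi>"
      using assms(2) 2(3) by (cases \<phi>; auto)+
    ultimately show ?thesis unfolding axiomatic_def by (metis insert_iff set_mset_add_mset_insert)
  qed
qed

text \<open>
  Induction on the height. If \<open>x\<close> is consumed by the last rule, a premise with its eigenlabels
  instantiated is already the claim. Otherwise \<open>x\<close> lies in the context; it is not among the
  formulas that the rule looks at, as those have no parts, so replacing it in all premises leaves
  the rule applicable, provided that its eigenlabels avoid the labels of \<open>C\<close>.
\<close>

theorem inversion:
  "bounded L CS n (add_mset x M) \<Longrightarrow> C \<in> parts x \<Longrightarrow> bounded L CS n (C + M)"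
proof (induction n arbitrary: M rule: less_induct)
  case (less n)
  from less.prems(1) finite_labs[of C] show ?case
  proof (cases rule: bounded_fresh_cases)
    case axiomatic
    then have "axiomatic M" using axiomatic_remove less.prems(2) by blast
    then have "axiomatic (C + M)" by (rule axiomatic_mono) simp
    with axiomatic(2) show ?thesis
      by (simp add: bounded.b_axiom parts_lang[OF less.prems(2)])
  next
    case (step k K X Cs V G)
    show ?thesis
    proof (cases "X = {#x#}")
      case True
      then have G: "G = M" using step(2) by simp
      have "V \<inter> labels (body x) = {}" using step(6) True by auto
      then obtain \<sigma> C' where \<sigma>: "C' \<in> Cs" "mrelabel \<sigma> C' = C" "\<And>w. w \<notin> V \<Longrightarrow> \<sigma> w = w"
        using scheme_instantiate[OF step(3)[unfolded True] _ less.prems(2)] by metis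
      have "mrelabel \<sigma> G = G"
        using step(6) by (intro mrelabel_ident \<sigma>(3)) auto
      then have "bounded L CS k (C + M)"
        using bounded_relabel_weaken[OF step(5)[OF \<sigma>(1)], of "{#}" \<sigma>] by (simp add: \<sigma>(2) G)
      then show ?thesis by (rule bounded_mono) (simp add: step(1))
    next
      case False
      then have "x \<notin># X" using scheme_principal[OF step(3)] by auto
      then have "x \<in># G" using step(2) by (metis union_iff union_single_eq_member)
      then obtain G' where G: "G = add_mset x G'" by (metis insert_DiffM)
      then have M: "M = X + G'" using step(2) by simp
      have "x \<notin># K" using scheme_kept[OF step(3)] less.prems(2) by auto
      then have K: "K \<subseteq># C + G'"
        using subseteq_add_mset_notin[of x K G'] step(4) by (simp add: G subset_mset.add_increasing)
      have "bounded L CS (Suc k) (X + (C + G'))"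
      proof (rule bounded.b_step[OF step(3) K])
        show "V \<inter> labs (X + (C + G')) = {}" using step(6) by (auto simp: G)
        show "bounded L CS k (C' + (C + G'))" if "C' \<in> Cs" for C'
          using less.IH[of k "C' + G'"] step(5)[OF that] less.prems(2)
          by (simp add: step(1) G union_lcomm)
      qed
      then show ?thesis by (simp add: M step(1) union_lcomm)
    qed
  qed
qed

section \<open>Contraction\<close>

text \<open>
  The induction sketched at the beginning. The formula \<open>x\<close> is generalized in the induction
  because the parts of a principal formula have to be contracted in turn; they are contracted in
  derivations of smaller height, so their size does not matter.
\<close>

theorem contraction:
  "bounded L CS n (add_mset x (add_mset x M)) \<Longrightarrow> bounded L CS n (add_mset x M)"
proof (induction n arbitrary: x M rule: less_induct)
  case (less n)
  from less.prems finite.emptyI show ?case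
  proof (cases rule: bounded_fresh_cases)
    case axiomatic
    have "axiomatic (add_mset x M)" by (rule axiomatic_mono[OF axiomatic(1)]) simp
    with axiomatic(2) show ?thesis by (simp add: bounded.b_axiom)
  next
    case (step k K X Cs V G)
    have IH: "bounded L CS k (add_mset y N)" if "bounded L CS k (add_mset y (add_mset y N))" for y N
      using less.IH[of k] that by (simp add: step(1))
    have IH': "bounded L CS k (C + N)" if "bounded L CS k (C + (C + N))" for C N
      using that
    proof (induction C arbitrary: N)
      case (add y C)
      then have "bounded L CS k (C + (C + add_mset y N))" 
        using IH[of y "C + (C + N)"] by simp
      then show ?case using add.IH by fastforce
    qed simp
    show ?thesis
    proof (cases "X = {#x#}")
      \<comment> \<open>One copy is consumed; the other is inverted in every premise.\<close>
      case True
      then have Cs: "Cs \<subseteq> parts x" using scheme_principal[OF step(3)] by auto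
      have G: "G = add_mset x M" using step(2) True by simp
      have "x \<notin># K" using scheme_kept[OF step(3)] scheme_nonempty[OF step(3)] Cs by auto
      then have "K \<subseteq># M" using subseteq_add_mset_notin[of x K M] step(4) by (simp add: G)
      then have "bounded L CS (Suc k) (X + M)"
      proof (rule bounded.b_step[OF step(3)])
        show "V \<inter> labs (X + M) = {}" using step(6) by (auto simp: G)
        show "bounded L CS k (C + M)" if "C \<in> Cs" for C
        proof (rule IH')
          have "bounded L CS k (add_mset x (C + M))" using step(5)[OF that] by (simp add: G)
          then show "bounded L CS k (C + (C + M))" using inversion Cs that by blast
        qed
      qed
      then show ?thesis by (simp add: True step(1))
    next
      case False
      then have "x \<notin># X" using scheme_principal[OF step(3)] by auto
      then have "count G x = count (add_mset x (add_mset x M)) x"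
        using step(2) by (simp add: not_in_iff)
      then have "{#x, x#} \<subseteq># G"
        by (intro mset_subset_eqI) auto
      then obtain G' where G: "G = add_mset x (add_mset x G')"
        by (auto simp: mset_subset_eq_exists_conv)
      then have M: "M = X + G'" using step(2) by simp
      \<comment> \<open>Both copies belong to the context, so they can be contracted in every premise.\<close>
      have prem: "bounded L CS k (C + add_mset x G')" if "C \<in> Cs" for C
        using step(5)[OF that] IH[of x "C + G'"] by (simp add: G)
      show ?thesis
      proof (cases "K \<subseteq># add_mset x G'")
        case True
        have "V \<inter> labs (X + add_mset x G') = {}" using step(6) by (auto simp: G)
        from bounded.b_step[OF step(3) True prem this] show ?thesis
          by (simp add: M step(1))
      next
        \<comment> \<open>The rule needs both copies: it is transitivity, and its premise contracts to the goal.\<close>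
        case K: False
        have "count K x \<ge> 2"
        proof (rule ccontr)
          assume "\<not> count K x \<ge> 2"
          then have "count K y \<le> count (add_mset x G') y" for y
            using mset_subset_eq_count[OF step(4), of y] by (auto simp: G)
          with K show False by (simp add: subseteq_mset_def)
        qed
        then have X: "X = {#}" and x: "{#x#} \<in> Cs" using scheme_kept_twice[OF step(3)] by auto
        from prem[OF x] have "bounded L CS k (add_mset x G')" using IH[of x G'] by simp
        then have "bounded L CS n (add_mset x G')" by (rule bounded_mono) (simp add: step(1))
        then show ?thesis by (simp add: M X)
      qed
    qed
  qed
qed

section \<open>Agreement with the calculus\<close>

text \<open>
  Both directions only compare the instances of \<open>scheme\<close> with the rules of the calculus, one by
  one. Heights of the premises differ in a derivation, but only their common bound counts.
\<close>

lemma bounded_imp_derivable: "bounded L CS n M \<Longrightarrow> derivable_height L CS n (unmerge M)"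
proof (induction rule: bounded.induct)
  case (b_axiom M n)
  then have "deriv L CS 0 (unmerge M)" by (simp add: deriv.Init axiomatic_unmerge in_lang_unmerge)
  then show ?case by (auto simp: derivable_height_def)
next
  case (b_step K X Cs V G n)
  obtain H where G: "G = K + H" using b_step.hyps(2) by (metis mset_subset_eq_exists_conv)
  have prem: "\<exists>m\<le>n. deriv L CS m (unmerge (K + C + H))" if "C \<in> Cs" for C
    using b_step.IH[OF that] by (simp add: G derivable_height_def union_ac)
  have fresh: "V \<inter> sequent_labels (unmerge (X + K + H)) = {}"
    using b_step.hyps(4) by (simp add: G labs_unmerge add.assoc)
  have one: "derivable_height L CS (Suc n) S"
    if "C \<in> Cs" "\<And>m. deriv L CS m (unmerge (K + C + H)) \<Longrightarrow> deriv L CS (Suc m) S" for C S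
    using prem[OF that(1)] that(2) unfolding derivable_height_def by (meson Suc_le_mono)
  have two: "derivable_height L CS (Suc n) S"
    if "C \<in> Cs" "D \<in> Cs" "\<And>m m'. deriv L CS m (unmerge (K + C + H)) \<Longrightarrow>
      deriv L CS m' (unmerge (K + D + H)) \<Longrightarrow> deriv L CS (Suc (max m m')) S" for C D S
    using prem[OF that(1)] prem[OF that(2)] that(3) unfolding derivable_height_def
    by (meson Suc_le_mono max.boundedI)
  obtain \<Gamma> \<Delta> where H: "image_mset body (filter_mset isl H) = \<Gamma>"
    "image_mset body (filter_mset (\<lambda>x. \<not> isl x) H) = \<Delta>" by blast
  have "derivable_height L CS (Suc n) (unmerge (X + K + H))"
    using b_step.hyps(1)
  proof cases
    case (s_prop x)
    show ?thesis
    proof (cases x rule: parts.cases)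
      case 1 show ?thesis
        by (rule one, use s_prop 1 in simp)
          (use s_prop 1 in \<open>simp add: unmerge_def H\<close>, rule deriv.LNeg, assumption+)
    next
      case 2 show ?thesis
        by (rule one, use s_prop 2 in simp)
          (use s_prop 2 in \<open>simp add: unmerge_def H\<close>, rule deriv.RNeg, assumption+)
    next
      case 3 show ?thesis
        by (rule one, use s_prop 3 in simp)
          (use s_prop 3 in \<open>simp add: unmerge_def H\<close>, rule deriv.LCon, assumption+)
    next
      case (4 w A B)
      show ?thesis
        by (rule two[of "{#Inr (w \<tturnstile> A)#}" "{#Inr (w \<tturnstile> B)#}"],
            use s_prop 4 in simp, use s_prop 4 in simp)
          (use s_prop 4 in \<open>simp add: unmerge_def H\<close>, rule deriv.RCon, assumption+)
    next
      case (5 w A B)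
      show ?thesis
        by (rule two[of "{#Inl (w \<tturnstile> A)#}" "{#Inl (w \<tturnstile> B)#}"],
            use s_prop 5 in simp, use s_prop 5 in simp)
          (use s_prop 5 in \<open>simp add: unmerge_def H\<close>, rule deriv.LDis, assumption+)
    next
      case 6 show ?thesis
        by (rule one, use s_prop 6 in simp)
          (use s_prop 6 in \<open>simp add: unmerge_def H\<close>, rule deriv.RDis, assumption+)
    next
      case (7 w A B)
      show ?thesis
        by (rule two[of "{#Inr (w \<tturnstile> A)#}" "{#Inl (w \<tturnstile> B)#}"],
            use s_prop 7 in simp, use s_prop 7 in simp)
          (use s_prop 7 in \<open>simp add: unmerge_def H\<close>, rule deriv.LImp, assumption+)
    next
      case 8 show ?thesis
        by (rule one, use s_prop 8 in simp)
          (use s_prop 8 in \<open>simp add: unmerge_def H\<close>, rule deriv.RImp, assumption+)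
    qed (use s_prop in auto)
  next
    case (s_RJust w t A v)
    have new: "v \<notin> sequent_labels (Evid w t A ,, \<Gamma> \<turnstile> w \<tturnstile> Just t A ,, \<Delta>)"
      using fresh s_RJust by (simp add: unmerge_def H del: sequent_labels.simps)
    show ?thesis
      by (rule one, use s_RJust in simp)
        (use s_RJust new in \<open>simp add: unmerge_def H del: sequent_labels.simps\<close>, rule deriv.RJust, assumption+)
  next
    case s_LJust show ?thesis
      by (rule one, use s_LJust in simp)
        (use s_LJust in \<open>simp add: unmerge_def H\<close>, rule deriv.LJust, assumption+)
  next
    case s_E show ?thesis
      by (rule one, use s_E in simp)
        (use s_E in \<open>simp add: unmerge_def H\<close>, rule deriv.E, assumption+)
  next
    case s_ElPlus show ?thesis
      by (rule one, use s_ElPlus in simp)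
        (use s_ElPlus in \<open>simp add: unmerge_def H\<close>, rule deriv.ElPlus, assumption+)
  next
    case s_ErPlus show ?thesis
      by (rule one, use s_ErPlus in simp)
        (use s_ErPlus in \<open>simp add: unmerge_def H\<close>, rule deriv.ErPlus, assumption+)
  next
    case s_EApp show ?thesis
      by (rule one, use s_EApp in simp)
        (use s_EApp in \<open>simp add: unmerge_def H\<close>, rule deriv.EApp, assumption+)
  next
    case s_AN show ?thesis
      by (rule one, use s_AN in simp)
        (use s_AN in \<open>simp add: unmerge_def H\<close>, rule deriv.AN, assumption+)
  next
    case s_Ref show ?thesis
      by (rule one, use s_Ref in simp)
        (use s_Ref in \<open>simp add: unmerge_def H\<close>, rule deriv.Ref, assumption+)
  next
    case (s_Ser w v)
    have new: "v \<notin> sequent_labels (\<Gamma> \<turnstile> \<Delta>)"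
      using fresh s_Ser by (simp add: unmerge_def H del: sequent_labels.simps)
    show ?thesis
      by (rule one, use s_Ser in simp)
        (use s_Ser new in \<open>simp add: unmerge_def H del: sequent_labels.simps\<close>, rule deriv.Ser, assumption+)
  next
    case s_EBang show ?thesis
      by (rule one, use s_EBang in simp)
        (use s_EBang in \<open>simp add: unmerge_def H\<close>, rule deriv.EBang, assumption+)
  next
    case s_Mon show ?thesis
      by (rule one, use s_Mon in simp)
        (use s_Mon in \<open>simp add: unmerge_def H\<close>, rule deriv.Mon, assumption+)
  next
    case s_Trans show ?thesis
      by (rule one, use s_Trans in simp)
        (use s_Trans in \<open>simp add: unmerge_def H\<close>, rule deriv.Trans, assumption+)
  next
    case (s_EBarQuest w A t)
    show ?thesis
      by (rule two[of "{#Inl (w \<tturnstile> A)#}" "{#Inl (Evid w (BarQuest t) (Neg (Just t A)))#}"],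
          use s_EBarQuest in simp, use s_EBarQuest in simp)
        (use s_EBarQuest in \<open>simp add: unmerge_def H\<close>, rule deriv.EBarQuest, assumption+)
  next
    case s_Sym show ?thesis
      by (rule one, use s_Sym in simp)
        (use s_Sym in \<open>simp add: unmerge_def H\<close>, rule deriv.Sym, assumption+)
  next
    case s_SE show ?thesis
      by (rule one, use s_SE in simp)
        (use s_SE in \<open>simp add: unmerge_def H\<close>, rule deriv.SE, assumption+)
  next
    case (s_EQuest w t A)
    show ?thesis
      by (rule two[of "{#Inl (Evid w t A)#}" "{#Inl (Evid w (Quest t) (Neg (Just t A)))#}"],
          use s_EQuest in simp, use s_EQuest in simp)
        (use s_EQuest in \<open>simp add: unmerge_def H\<close>, rule deriv.EQuest, assumption+)
  qed
  then show ?case by (simp add: G add.assoc)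
qed

lemma bounded_stepI:
  assumes "scheme L CS K X Cs V" and "M = X + (K + G)"
    and "\<forall>C\<in>Cs. bounded L CS n (C + (K + G))" and "V \<inter> labs M = {}"
  shows "bounded L CS (Suc n) M"
  using bounded.b_step[OF assms(1), of "K + G" n] assms by simp

lemma deriv_imp_bounded: "deriv L CS n S \<Longrightarrow> bounded L CS n (merge S)"
proof (induction rule: deriv.induct)
  case (Init S)
  then show ?case by (metis b_axiom axiomatic_unmerge in_lang_unmerge unmerge_merge)
next
  case (LNeg n \<Gamma> w A \<Delta>)
  then show ?case
    by (intro bounded_stepI[OF scheme.s_prop[where x = "Inl (w \<tturnstile> Neg A)"], where G = "merge (\<Gamma> \<turnstile> \<Delta>)"])
      (auto simp: merge_def add_mset_commute)
next
  case (RNeg n w A \<Gamma> \<Delta>)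
  then show ?case
    by (intro bounded_stepI[OF scheme.s_prop[where x = "Inr (w \<tturnstile> Neg A)"], where G = "merge (\<Gamma> \<turnstile> \<Delta>)"])
      (auto simp: merge_def add_mset_commute)
next
  case (LCon n w A B \<Gamma> \<Delta>)
  then show ?case
    by (intro bounded_stepI[OF scheme.s_prop[where x = "Inl (w \<tturnstile> Con A B)"], where G = "merge (\<Gamma> \<turnstile> \<Delta>)"])
      (auto simp: merge_def add_mset_commute)
next
  case (RCon m \<Gamma> w A \<Delta> n B)
  then show ?case
    by (intro bounded_stepI[OF scheme.s_prop[where x = "Inr (w \<tturnstile> Con A B)"], where G = "merge (\<Gamma> \<turnstile> \<Delta>)"])
      (auto simp: merge_def add_mset_commute intro: bounded_mono)
next
  case (LDis m w A \<Gamma> \<Delta> n B)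
  then show ?case
    by (intro bounded_stepI[OF scheme.s_prop[where x = "Inl (w \<tturnstile> Dis A B)"], where G = "merge (\<Gamma> \<turnstile> \<Delta>)"])
      (auto simp: merge_def add_mset_commute intro: bounded_mono)
next
  case (RDis n \<Gamma> w A B \<Delta>)
  then show ?case
    by (intro bounded_stepI[OF scheme.s_prop[where x = "Inr (w \<tturnstile> Dis A B)"], where G = "merge (\<Gamma> \<turnstile> \<Delta>)"])
      (auto simp: merge_def add_mset_commute)
next
  case (LImp m \<Gamma> w A \<Delta> n B)
  then show ?case
    by (intro bounded_stepI[OF scheme.s_prop[where x = "Inl (w \<tturnstile> Imp A B)"], where G = "merge (\<Gamma> \<turnstile> \<Delta>)"])
      (auto simp: merge_def add_mset_commute intro: bounded_mono)
next
  case (RImp n w A \<Gamma> B \<Delta>)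
  then show ?case
    by (intro bounded_stepI[OF scheme.s_prop[where x = "Inr (w \<tturnstile> Imp A B)"], where G = "merge (\<Gamma> \<turnstile> \<Delta>)"])
      (auto simp: merge_def add_mset_commute)
next
  case (RJust n w v t A \<Gamma> \<Delta>)
  then show ?case
    by (intro bounded_stepI[OF scheme.s_RJust[where w = w and t = t and A = A and v = v], where G = "merge (\<Gamma> \<turnstile> \<Delta>)"])
      (auto simp: merge_def labs_def add_mset_commute)
next
  case (LJust n v A w t \<Gamma> \<Delta>)
  then show ?case
    by (intro bounded_stepI[OF scheme.s_LJust[where w = w and t = t and A = A and v = v], where G = "merge (\<Gamma> \<turnstile> \<Delta>)"])
      (auto simp: merge_def add_mset_commute)
next
  case (E n w t A \<Gamma> \<Delta>)
  then show ?case
    by (intro bounded_stepI[OF scheme.s_E[where w = w and t = t and A = A], where G = "merge (\<Gamma> \<turnstile> \<Delta>)"])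
      (auto simp: merge_def add_mset_commute)
next
  case (ElPlus n w s t A \<Gamma> \<Delta>)
  then show ?case
    by (intro bounded_stepI[OF scheme.s_ElPlus[where w = w and t = t and A = A and s = s], where G = "merge (\<Gamma> \<turnstile> \<Delta>)"])
      (auto simp: merge_def add_mset_commute)
next
  case (ErPlus n w t s A \<Gamma> \<Delta>)
  then show ?case
    by (intro bounded_stepI[OF scheme.s_ErPlus[where w = w and t = t and A = A and s = s], where G = "merge (\<Gamma> \<turnstile> \<Delta>)"])
      (auto simp: merge_def add_mset_commute)
next
  case (EApp n w s t B A \<Gamma> \<Delta>)
  then show ?case
    by (intro bounded_stepI[OF scheme.s_EApp[where w = w and s = s and A = A and B = B and t = t], where G = "merge (\<Gamma> \<turnstile> \<Delta>)"])
      (auto simp: merge_def add_mset_commute)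
next
  case (AN c F n w \<Gamma> \<Delta>)
  then show ?case
    by (intro bounded_stepI[OF scheme.s_AN[where c = c and F = F and w = w, OF AN(1)], where G = "merge (\<Gamma> \<turnstile> \<Delta>)"])
      (auto simp: merge_def add_mset_commute)
next
  case (Ref n w \<Gamma> \<Delta>)
  then show ?case
    by (intro bounded_stepI[OF scheme.s_Ref[where w = w, OF Ref(1)], where G = "merge (\<Gamma> \<turnstile> \<Delta>)"])
      (auto simp: merge_def add_mset_commute)
next
  case (Ser n w v \<Gamma> \<Delta>)
  then show ?case
    by (intro bounded_stepI[OF scheme.s_Ser[where w = w and v = v, OF Ser(1)], where G = "merge (\<Gamma> \<turnstile> \<Delta>)"])
      (auto simp: merge_def labs_def add_mset_commute)
next
  case (EBang n w t A \<Gamma> \<Delta>)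
  then show ?case
    by (intro bounded_stepI[OF scheme.s_EBang[where w = w and t = t and A = A, OF EBang(1)], where G = "merge (\<Gamma> \<turnstile> \<Delta>)"])
      (auto simp: merge_def add_mset_commute)
next
  case (Mon n v t A w \<Gamma> \<Delta>)
  then show ?case
    by (intro bounded_stepI[OF scheme.s_Mon[where w = w and t = t and A = A and v = v, OF Mon(1)], where G = "merge (\<Gamma> \<turnstile> \<Delta>)"])
      (auto simp: merge_def add_mset_commute)
next
  case (Trans n w u v \<Gamma> \<Delta>)
  then show ?case
    by (intro bounded_stepI[OF scheme.s_Trans[where w = w and v = v and u = u, OF Trans(1)], where G = "merge (\<Gamma> \<turnstile> \<Delta>)"])
      (auto simp: merge_def add_mset_commute)
next
  case (EBarQuest m w A \<Gamma> \<Delta> n t)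
  then show ?case
    by (intro bounded_stepI[OF scheme.s_EBarQuest[where w = w and A = A and t = t, OF EBarQuest(1)], where G = "merge (\<Gamma> \<turnstile> \<Delta>)"])
      (auto simp: merge_def add_mset_commute intro: bounded_mono)
next
  case (Sym n v w \<Gamma> \<Delta>)
  then show ?case
    by (intro bounded_stepI[OF scheme.s_Sym[where w = w and v = v, OF Sym(1)], where G = "merge (\<Gamma> \<turnstile> \<Delta>)"])
      (auto simp: merge_def add_mset_commute)
next
  case (SE n w t A \<Gamma> \<Delta>)
  then show ?case
    by (intro bounded_stepI[OF scheme.s_SE[where w = w and t = t and A = A, OF SE(1)], where G = "merge (\<Gamma> \<turnstile> \<Delta>)"])
      (auto simp: merge_def add_mset_commute)
next
  case (EQuest m w t A \<Gamma> \<Delta> n)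
  then show ?case
    by (intro bounded_stepI[OF scheme.s_EQuest[where w = w and t = t and A = A, OF EQuest(1)], where G = "merge (\<Gamma> \<turnstile> \<Delta>)"])
      (auto simp: merge_def add_mset_commute intro: bounded_mono)
qed

theorem theorem7p2:
  fixes L :: logic and CS :: "('c, 'v, 'p) fm set"
  assumes "justification_logic L"
    and "constant_specification L CS"
  shows "hp_CS_admissible L CS LC \<and> hp_CS_admissible L CS RC"
proof -
  have iff: "derivable_height L CS n S \<longleftrightarrow> bounded L CS n (merge S)" for n and S :: "('c, 'v, 'p) sequent"
    using bounded_imp_derivable[of L CS n "merge S"] deriv_imp_bounded[of L CS _ S]
      bounded_mono[of L CS _ "merge S" n]
    by (auto simp: unmerge_merge derivable_height_def)
  show ?thesis
    unfolding hp_CS_admissible_def LC_def RC_def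
    by (auto simp: iff merge_def intro: contraction)
qed

end
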